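(* Let $G$ be a directed graph on the vertex set $\{1,\ldots,n\}$ and let $r>0$. If $G$ can spin independently with radius $r$, then $d\theta^{\wedge G}\notin \ker i_{n,r}^*$.
   Context: $D^2$ is the closed unit disk in $\mathbb{R}^2$. $\mathrm{Conf}_n$ is the space of ordered $n$-tuples $\vec{x}=(x_1,\ldots,x_n)$ of distinct points of $D^2$, and $\mathrm{Conf}_{n,r}\subseteq \mathrm{Conf}_n$ is the subspace of those $\vec{x}$ for which the open disks of radius $r$ centered at $x_1,\ldots,x_n$ are pairwise disjoint and contained in $D^2$. The inclusion is $i_{n,r}:\mathrm{Conf}_{n,r}\to\mathrm{Conf}_n$, inducing $i_{n,r}^*:H^*(\mathrm{Conf}_n)\to H^*(\mathrm{Conf}_{n,r})$ on integral singular cohomology. For a directed graph $G$ (without loops) on $\{1,\ldots,n\}$ with edge set $E(G)$, the angle map $\alpha_G:\mathrm{Conf}_n\to (S^1)^{|E(G)|}$ records, for each edge $i\to j$, the unit vector $\frac{x_j-x_i}{|x_j-x_i|}$; put $\alpha_{G,r}=\alpha_G\circ i_{n,r}$. We say $G$ can spin independently with radius $r$ if there is a continuous map $f:(S^1)^{|E(G)|}\to\mathrm{Conf}_{n,r}$ such that $\alpha_{G,r}\circ f$ is the identity. With $S^1=\mathbb{R}/\mathbb{Z}$ and $d\theta$ the generator of $H^1(S^1)$, the class $d\theta^{\wedge G}\in H^{|E(G)|}(\mathrm{Conf}_n)$ is the pullback $\alpha_G^*(d\theta_1\wedge\cdots\wedge d\theta_{|E(G)|})$ of the fundamental cohomology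 class of $(S^1)^{|E(G)|}$. *)

theory Defs
  imports "HOL-Homology.Homology" "Graph_Theory.Pair_Digraph"
begin

section \<open>Integral singular cohomology\<close>

text \<open>The library provides the singular chain groups \<^const>\<open>chain_group\<close>; the singular cochains are
  their duals. A homomorphism is represented by the function that is \<open>undefined\<close> off the chain group,
  so that equality of functions is equality of cochains.\<close>

type_synonym 'a cochain = "'a chain \<Rightarrow> int"

definition cochain_group :: "nat \<Rightarrow> 'a topology \<Rightarrow> 'a cochain monoid" where
  "cochain_group p X =
    \<lparr>carrier = hom (chain_group p X) integer_group \<inter> extensional (carrier (chain_group p X)),
     monoid.mult = (\<lambda>\<phi> \<psi>. \<lambda>c\<in>carrier (chain_group p X). \<phi> c + \<psi> c),
     one = (\<lambda>c\<in>carrier (chain_group p X). 0)\<rparr>"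

definition coboundary :: "nat \<Rightarrow> 'a topology \<Rightarrow> 'a cochain \<Rightarrow> 'a cochain" where
  "coboundary p X \<phi> = (\<lambda>c\<in>carrier (chain_group (Suc p) X). \<phi> (chain_boundary (Suc p) c))"

definition cocycles :: "nat \<Rightarrow> 'a topology \<Rightarrow> 'a cochain set" where
  "cocycles p X = kernel (cochain_group p X) (cochain_group (Suc p) X) (coboundary p X)"

primrec coboundaries :: "nat \<Rightarrow> 'a topology \<Rightarrow> 'a cochain set" where
  "coboundaries 0 X = {one (cochain_group 0 X)}"
| "coboundaries (Suc p) X = coboundary p X ` carrier (cochain_group p X)"

definition cohomology_group :: "nat \<Rightarrow> 'a topology \<Rightarrow> 'a cochain set monoid" where
  "cohomology_group p X =
    subgroup_generated (cochain_group p X) (cocycles p X) Mod coboundaries p X"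

definition cohomology_class :: "nat \<Rightarrow> 'a topology \<Rightarrow> 'a cochain \<Rightarrow> 'a cochain set" where
  "cohomology_class p X \<phi> = coboundaries p X #>\<^bsub>cochain_group p X\<^esub> \<phi>"

text \<open>Maps on cohomology are given on representatives; the union over all representatives of a class
  is a union of equal cosets.\<close>

definition cochain_map :: "nat \<Rightarrow> 'a topology \<Rightarrow> ('a \<Rightarrow> 'b) \<Rightarrow> 'b cochain \<Rightarrow> 'a cochain" where
  "cochain_map p X f \<phi> = (\<lambda>c\<in>carrier (chain_group p X). \<phi> (chain_map p f c))"

definition cohomology_induced ::
    "nat \<Rightarrow> 'a topology \<Rightarrow> ('a \<Rightarrow> 'b) \<Rightarrow> 'b cochain set \<Rightarrow> 'a cochain set" where
  "cohomology_induced p X f A = (\<Union>\<phi>\<in>A. cohomology_class p X (cochain_map p X f \<phi>))"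

text \<open>The cup product by the Alexander-Whitney formula: the first cochain is evaluated on the face with
  vertices \<open>0,\<dots>,p\<close>, the second on the face with vertices \<open>p,\<dots>,p+q\<close>.\<close>

definition front_face :: "nat \<Rightarrow> ((nat \<Rightarrow> real) \<Rightarrow> 'a) \<Rightarrow> (nat \<Rightarrow> real) \<Rightarrow> 'a" where
  "front_face p \<sigma> = (\<lambda>x\<in>standard_simplex p. \<sigma> x)"

definition back_face :: "nat \<Rightarrow> nat \<Rightarrow> ((nat \<Rightarrow> real) \<Rightarrow> 'a) \<Rightarrow> (nat \<Rightarrow> real) \<Rightarrow> 'a" where
  "back_face p q \<sigma> = (\<lambda>x\<in>standard_simplex q. \<sigma> (\<lambda>i. if i < p then 0 else x (i - p)))"

definition cup_cochain ::
    "nat \<Rightarrow> nat \<Rightarrow> 'a topology \<Rightarrow> 'a cochain \<Rightarrow> 'a cochain \<Rightarrow> 'a cochain" where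
  "cup_cochain p q X \<phi> \<psi> = (\<lambda>c\<in>carrier (chain_group (p + q) X).
    \<Sum>\<sigma>\<in>Poly_Mapping.keys c. Poly_Mapping.lookup c \<sigma> *
      (\<phi> (frag_of (front_face p \<sigma>)) * \<psi> (frag_of (back_face p q \<sigma>))))"

definition cup ::
    "nat \<Rightarrow> nat \<Rightarrow> 'a topology \<Rightarrow> 'a cochain set \<Rightarrow> 'a cochain set \<Rightarrow> 'a cochain set" where
  "cup p q X A B = (\<Union>\<phi>\<in>A. \<Union>\<psi>\<in>B. cohomology_class (p + q) X (cup_cochain p q X \<phi> \<psi>))"

definition unit_class :: "'a topology \<Rightarrow> 'a cochain set" where
  "unit_class X = cohomology_class 0 X
    (\<lambda>c\<in>carrier (chain_group 0 X). \<Sum>\<sigma>\<in>Poly_Mapping.keys c. Poly_Mapping.lookup c \<sigma>)"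

text \<open>The product \<open>a\<^sub>1 \<and> \<dots> \<and> a\<^sub>k\<close> of degree-one classes; the empty product is the unit.\<close>

primrec wedge :: "'a topology \<Rightarrow> 'a cochain set list \<Rightarrow> 'a cochain set" where
  "wedge X [] = unit_class X"
| "wedge X (a # as) = cup 1 (length as) X a (wedge X as)"


section \<open>Configuration spaces of the disk and angle maps\<close>

text \<open>Tuples are functions on \<open>{1..n}\<close>, \<open>undefined\<close> elsewhere.\<close>

definition Conf :: "nat \<Rightarrow> (nat \<Rightarrow> real^2) topology" where
  "Conf n = subtopology (product_topology (\<lambda>i. top_of_set (cball 0 1)) {1..n})
     {x. inj_on x {1..n}}"

definition Conf_r :: "nat \<Rightarrow> real \<Rightarrow> (nat \<Rightarrow> real^2) topology" where
  "Conf_r n r = subtopology (Conf n)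
     {x. disjoint_family_on (\<lambda>i. ball (x i) r) {1..n} \<and> (\<forall>i\<in>{1..n}. ball (x i) r \<subseteq> cball 0 1)}"

definition conf_inclusion :: "(nat \<Rightarrow> real^2) \<Rightarrow> (nat \<Rightarrow> real^2)" where
  "conf_inclusion = id"

definition circle :: "(real^2) topology" where
  "circle = top_of_set (sphere 0 1)"

text \<open>The torus has one coordinate for each edge, an edge \<open>i \<rightarrow> j\<close> being the pair \<open>(i, j)\<close>.\<close>

definition torus :: "nat pair_pre_digraph \<Rightarrow> (nat \<times> nat \<Rightarrow> real^2) topology" where
  "torus G = product_topology (\<lambda>e. circle) (parcs G)"

definition angle_map :: "nat pair_pre_digraph \<Rightarrow> (nat \<Rightarrow> real^2) \<Rightarrow> (nat \<times> nat \<Rightarrow> real^2)" where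
  "angle_map G x = (\<lambda>(i, j)\<in>parcs G. (x j - x i) /\<^sub>R norm (x j - x i))"

definition spins_independently :: "nat \<Rightarrow> nat pair_pre_digraph \<Rightarrow> real \<Rightarrow> bool" where
  "spins_independently n G r \<longleftrightarrow>
    (\<exists>f. continuous_map (torus G) (Conf_r n r) f \<and>
         (\<forall>t\<in>topspace (torus G). (angle_map G \<circ> conf_inclusion) (f t) = t))"

definition circle_generator :: "(real^2) cochain set \<Rightarrow> bool" where
  "circle_generator d\<theta> \<longleftrightarrow> d\<theta> \<in> carrier (cohomology_group 1 circle) \<and>
     generate (cohomology_group 1 circle) {d\<theta>} = carrier (cohomology_group 1 circle)"

text \<open>The list \<open>es\<close> enumerates the edges and thereby fixes the order of the factors
  \<open>d\<theta>\<^sub>1, \<dots>, d\<theta>\<^sub>k\<close>; the factor of an edge is the pullback of \<open>d\<theta>\<close> along that coordinate.\<close>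

definition torus_class ::
    "nat pair_pre_digraph \<Rightarrow> (nat \<times> nat) list \<Rightarrow> (real^2) cochain set
      \<Rightarrow> (nat \<times> nat \<Rightarrow> real^2) cochain set" where
  "torus_class G es d\<theta> =
     wedge (torus G) (map (\<lambda>e. cohomology_induced 1 (torus G) (\<lambda>t. t e) d\<theta>) es)"

definition angle_class ::
    "nat \<Rightarrow> nat pair_pre_digraph \<Rightarrow> (nat \<times> nat) list \<Rightarrow> (real^2) cochain set
      \<Rightarrow> (nat \<Rightarrow> real^2) cochain set" where
  "angle_class n G es d\<theta> =
     cohomology_induced (card (parcs G)) (Conf n) (angle_map G) (torus_class G es d\<theta>)"

end

theory Submission
  imports Defs "HOL-Analysis.Further_Topology" "HOL-Combinatorics.Permutations"
begin

text \<open>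
Let \<open>f\<close> be the map from the torus that witnesses independent spinning. The composite of
\<open>f\<close>, the inclusion and the angle map is the identity of the torus, so pulling the angle class
back along \<open>f\<close> after restricting it to the small configuration space returns the product class of
the torus. If the restriction were trivial, the product class would be trivial too. What has to be shown is
therefore that the product of the pulled-back generators of the circle is nonzero on the torus.

This is done by pairing a cocycle with a cycle. A class such as \<open>wedge\<close> is a union over
representatives, so it contains the cochain obtained from any particular choice of representatives
(\<open>cup_list_mem_wedge\<close>); and a coboundary vanishes on every cycle
(\<open>coboundary_vanishes_on_cycle\<close>). It remains to find one cycle on which one representative does
not vanish.

The cycle is the fundamental cycle of the torus that comes from cutting the unit cube into simplices
\<open>t\<^sub>p\<^sub>1 \<le> t\<^sub>p\<^sub>2 \<le> \<dots>\<close>, one for each permutation, with the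
sign of the permutation as coefficient. Walls inside the cube are shared by two simplices that differ by a
transposition; opposite sides of the cube are glued in the torus and are matched by a cyclic shift of the
coordinates (\<open>torus_cycle_is_cycle\<close>). By the Alexander-Whitney formula, a product of degree-one
cochains takes on a simplex the product of the values along its consecutive edges
(\<open>cup_list_simplex\<close>). On the simplex of a permutation each such edge runs around exactly one
circle factor, and the \<open>i\<close>-th cochain only sees the \<open>i\<close>-th factor, so only the
identity permutation contributes, and it contributes a power of the value of the generator on the standard
loop (\<open>cup_list_torus_cycle\<close>).

Finally, a generator of the first cohomology of the circle cannot vanish on the standard loop: if it did, so
would every class, but the winding number cocycle takes the value \<open>-1\<close> there
(\<open>circle_generator_nonzero_on_loop\<close>). That cocycle is built from lifts of singular simplices to
the real line.
\<close>

section \<open>Linear functionals on chains\<close>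

text \<open>The counterpart of \<open>frag_extend\<close> for functions on generators that take integer
values.\<close>

definition frag_eval :: "('b \<Rightarrow> int) \<Rightarrow> ('b \<Rightarrow>\<^sub>0 int) \<Rightarrow> int" where
  "frag_eval g c = (\<Sum>i\<in>Poly_Mapping.keys c. Poly_Mapping.lookup c i * g i)"

lemma frag_eval_superset:
  assumes "finite S" "Poly_Mapping.keys c \<subseteq> S"
  shows "frag_eval g c = (\<Sum>i\<in>S. Poly_Mapping.lookup c i * g i)"
  unfolding frag_eval_def
  by (rule sum.mono_neutral_left) (use assms in \<open>auto simp: in_keys_iff\<close>)

lemma frag_eval_0 [simp]: "frag_eval g 0 = 0"
  by (simp add: frag_eval_def)

lemma frag_eval_of [simp]: "frag_eval g (frag_of a) = g a"
  by (simp add: frag_eval_def)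

lemma frag_eval_add: "frag_eval g (a + b) = frag_eval g a + frag_eval g b"
proof -
  let ?S = "Poly_Mapping.keys a \<union> Poly_Mapping.keys b"
  have "Poly_Mapping.keys (a + b) \<subseteq> ?S"
    by (rule Poly_Mapping.keys_add)
  then show ?thesis
    by (simp add: frag_eval_superset [of ?S] Poly_Mapping.lookup_add distrib_right sum.distrib)
qed

lemma frag_eval_minus: "frag_eval g (- a) = - frag_eval g a"
  by (metis add.right_inverse add_eq_0_iff frag_eval_0 frag_eval_add)

lemma frag_eval_diff: "frag_eval g (a - b) = frag_eval g a - frag_eval g b"
  using frag_eval_add[of g a "- b"] by (simp add: frag_eval_minus)

lemma frag_eval_cmul: "frag_eval g (frag_cmul k a) = k * frag_eval g a"
  by (subst frag_eval_superset [of "Poly_Mapping.keys a"])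
     (auto simp: frag_eval_def sum_distrib_left mult.assoc keys_cmul)

lemma frag_eval_sum: "frag_eval g (sum f I) = (\<Sum>i\<in>I. frag_eval g (f i))"
  by (induction I rule: infinite_finite_induct) (simp_all add: frag_eval_add)

section \<open>The singular cochain complex\<close>

lemma cochain_group_simps [simp]:
  "carrier (cochain_group p X) =
     hom (chain_group p X) integer_group \<inter> extensional (singular_chain_set p X)"
  "\<phi> \<otimes>\<^bsub>cochain_group p X\<^esub> \<psi> = (\<lambda>c\<in>singular_chain_set p X. \<phi> c + \<psi> c)"
  "\<one>\<^bsub>cochain_group p X\<^esub> = (\<lambda>c\<in>singular_chain_set p X. 0)"
  by (simp_all add: cochain_group_def)

lemma cochain_iff:
  "\<phi> \<in> carrier (cochain_group p X) \<longleftrightarrow>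
    (\<forall>a b. singular_chain p X a \<longrightarrow> singular_chain p X b \<longrightarrow> \<phi> (a + b) = \<phi> a + \<phi> b)
    \<and> \<phi> \<in> extensional (singular_chain_set p X)"
  by (auto simp: hom_def Pi_iff)

lemma comm_group_cochain_group: "comm_group (cochain_group p X)"
proof (rule comm_groupI)
  fix \<phi> assume \<phi>: "\<phi> \<in> carrier (cochain_group p X)"
  have "(\<lambda>c\<in>singular_chain_set p X. - \<phi> c) \<in> carrier (cochain_group p X)"
    using \<phi> by (auto simp: cochain_iff singular_chain_add simp del: cochain_group_simps)
  moreover have "(\<lambda>c\<in>singular_chain_set p X. - \<phi> c) \<otimes>\<^bsub>cochain_group p X\<^esub> \<phi>
      = \<one>\<^bsub>cochain_group p X\<^esub>"
    by auto
  ultimately show "\<exists>\<psi>\<in>carrier (cochain_group p X). \<psi> \<otimes>\<^bsub>cochain_group p X\<^esub> \<phi> = \<one>\<^bsub>cochain_group p X\<^esub>"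
    by blast
next
  fix \<phi> assume \<phi>: "\<phi> \<in> carrier (cochain_group p X)"
  then show "\<one>\<^bsub>cochain_group p X\<^esub> \<otimes>\<^bsub>cochain_group p X\<^esub> \<phi> = \<phi>"
    by (auto simp: extensional_def)
qed (auto simp: hom_def singular_chain_add)

lemma cochain_zero [simp]:
  assumes "\<phi> \<in> carrier (cochain_group p X)" shows "\<phi> 0 = 0"
  using assms unfolding cochain_iff
  by (metis add_cancel_right_right singular_chain_0)

lemma group_hom_coboundary:
  "group_hom (cochain_group p X) (cochain_group (Suc p) X) (coboundary p X)"
proof -
  have "coboundary p X \<phi> \<in> carrier (cochain_group (Suc p) X)"
    if "\<phi> \<in> carrier (cochain_group p X)" for \<phi>
    using that unfolding cochain_iff coboundary_def
    by (auto simp: singular_chain_add chain_boundary_add singular_chain_boundary_alt)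
  then show ?thesis
    by (auto simp: group_hom_def group_hom_axioms_def hom_def [of "cochain_group p X"] coboundary_def
        comm_group.axioms(2) [OF comm_group_cochain_group] singular_chain_boundary_alt
        simp del: cochain_group_simps(1))
qed

lemma coboundaries_Suc_subset_cocycles: "coboundaries (Suc p) X \<subseteq> cocycles (Suc p) X"
proof -
  have "coboundary (Suc p) X (coboundary p X \<phi>) = \<one>\<^bsub>cochain_group (Suc (Suc p)) X\<^esub>"
    if "\<phi> \<in> carrier (cochain_group p X)" for \<phi>
    using chain_boundary_boundary_alt [of "Suc p" X] cochain_zero [OF that]
    by (auto simp: coboundary_def singular_chain_boundary_alt simp del: cochain_group_simps(1))
  moreover have "coboundary p X \<phi> \<in> carrier (cochain_group (Suc p) X)"
    if "\<phi> \<in> carrier (cochain_group p X)" for \<phi>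
    using group_hom.hom_closed [OF group_hom_coboundary that] .
  ultimately show ?thesis
    by (auto simp: cocycles_def kernel_def simp del: cochain_group_simps)
qed

lemma zero_mem_coboundaries: "(\<lambda>c\<in>singular_chain_set p X. 0) \<in> coboundaries p X"
proof (cases p)
  case (Suc q)
  have "(\<lambda>c\<in>singular_chain_set p X. 0) = coboundary q X (\<one>\<^bsub>cochain_group q X\<^esub>)"
    by (auto simp: coboundary_def Suc singular_chain_boundary_alt)
  moreover have "\<one>\<^bsub>cochain_group q X\<^esub> \<in> carrier (cochain_group q X)"
    using comm_group_cochain_group comm_group_def group_def monoid.one_closed by blast
  ultimately show ?thesis
    using Suc by (auto simp del: cochain_group_simps)
qed simp

text \<open>The maps and products on cohomology are unions over all representatives of classes of cochains.
This lemma is what makes one explicit representative enough to work with. It holds because the zero cochain is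
a coboundary; extensionality makes adding zero the identity.\<close>

lemma mem_cohomology_class:
  assumes "\<phi> \<in> extensional (singular_chain_set p X)"
  shows "\<phi> \<in> cohomology_class p X \<phi>"
proof -
  have "\<phi> = (\<lambda>c\<in>singular_chain_set p X. 0) \<otimes>\<^bsub>cochain_group p X\<^esub> \<phi>"
    using assms by (auto simp: extensional_def)
  then show ?thesis
    using zero_mem_coboundaries unfolding cohomology_class_def r_coset_def by blast
qed

text \<open>The duality \<open>(\<delta>\<phi>)(z) = \<phi>(\<partial>z)\<close> in the form in which it
detects nontrivial classes.\<close>

lemma coboundary_vanishes_on_cycle:
  assumes "\<psi> \<in> coboundaries p X" "singular_chain p X z" "chain_boundary p z = 0"
  shows "\<psi> z = 0"
proof (cases p)
  case (Suc q)
  with assms show ?thesis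
    using cochain_zero by (force simp: coboundary_def simp del: cochain_group_simps)
qed (use assms in auto)

lemma subgroup_cocycles: "subgroup (cocycles p X) (cochain_group p X)"
  unfolding cocycles_def by (rule group_hom.subgroup_kernel [OF group_hom_coboundary])

text \<open>Evaluation on the cycle \<open>z\<close> kills coboundaries, so it descends to a homomorphism from
the cohomology group to the integers. If it were zero at a generator, it would be zero everywhere, including
the class of \<open>w\<close>.\<close>

lemma generator_nonzero_on_cycle:
  assumes gen: "generate (cohomology_group (Suc p) X) {A} = carrier (cohomology_group (Suc p) X)"
    and A: "A \<in> carrier (cohomology_group (Suc p) X)"
    and w: "w \<in> cocycles (Suc p) X" "w z \<noteq> 0"
    and z: "singular_chain (Suc p) X z" "chain_boundary (Suc p) z = 0"
  obtains \<phi> where "\<phi> \<in> A" "\<phi> \<in> cocycles (Suc p) X" "\<phi> z \<noteq> 0"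
proof -
  let ?C = "cochain_group (Suc p) X"
  let ?Z = "subgroup_generated ?C (cocycles (Suc p) X)"
  interpret C: comm_group ?C by (rule comm_group_cochain_group)
  have carZ: "carrier ?Z = cocycles (Suc p) X"
    by (rule subgroup.carrier_subgroup_generated_subgroup [OF subgroup_cocycles])
  interpret Z: comm_group ?Z
    by (rule C.abelian_subgroup_generated) (rule comm_group_cochain_group)
  have "subgroup (coboundaries (Suc p) X) ?C"
    using group_hom.img_is_subgroup [OF group_hom_coboundary] by simp
  then have "subgroup (coboundaries (Suc p) X) ?Z"
    using coboundaries_Suc_subset_cocycles
    by (simp add: C.subgroup_subgroup_generated_iff carZ)
  then have normal: "coboundaries (Suc p) X \<lhd> ?Z"
    by (rule Z.subgroup_imp_normal)
  have evhom: "group_hom ?Z integer_group (\<lambda>\<phi>. \<phi> z)"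
    using z by (auto simp: group_hom_def group_hom_axioms_def hom_def)
  have "coboundaries (Suc p) X \<subseteq> kernel ?Z integer_group (\<lambda>\<phi>. \<phi> z)"
    using coboundary_vanishes_on_cycle [OF _ z] coboundaries_Suc_subset_cocycles
    by (auto simp: kernel_def carZ simp del: coboundaries.simps)
  then obtain g where g: "g \<in> hom (?Z Mod coboundaries (Suc p) X) integer_group"
      and geq: "\<And>\<phi>. \<phi> \<in> carrier ?Z \<Longrightarrow> g (coboundaries (Suc p) X #>\<^bsub>?Z\<^esub> \<phi>) = \<phi> z"
    using group_hom.FactGroup_universal_kernel [OF evhom normal] by blast
  interpret H: group "cohomology_group (Suc p) X"
    unfolding cohomology_group_def by (rule normal.factorgroup_is_group [OF normal])
  interpret g: group_hom "cohomology_group (Suc p) X" integer_group g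
    using g H.group_axioms by (simp add: group_hom_def group_hom_axioms_def cohomology_group_def)
  have coset_mem: "coboundaries (Suc p) X #>\<^bsub>?Z\<^esub> \<phi> \<in> carrier (cohomology_group (Suc p) X)"
    if "\<phi> \<in> cocycles (Suc p) X" for \<phi>
    using that carZ by (auto simp: cohomology_group_def FactGroup_def RCOSETS_def)
  obtain \<phi> where \<phi>: "\<phi> \<in> cocycles (Suc p) X" and Aeq: "A = coboundaries (Suc p) X #>\<^bsub>?Z\<^esub> \<phi>"
    using A carZ by (auto simp: cohomology_group_def FactGroup_def RCOSETS_def)
  have "\<phi> \<in> A"
    unfolding Aeq using \<phi> by (metis Z.rcos_self \<open>subgroup _ ?Z\<close> carZ)
  moreover have "\<phi> z \<noteq> 0"
  proof
    assume "\<phi> z = 0"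
    then have "{A} \<subseteq> kernel (cohomology_group (Suc p) X) integer_group g"
      using A geq \<phi> Aeq carZ by (auto simp: kernel_def)
    then have "generate (cohomology_group (Suc p) X) {A}
        \<subseteq> kernel (cohomology_group (Suc p) X) integer_group g"
      by (rule H.generate_subgroup_incl [OF _ g.subgroup_kernel])
    then have "g (coboundaries (Suc p) X #>\<^bsub>?Z\<^esub> w) = 0"
      using gen coset_mem [OF w(1)] by (auto simp: kernel_def)
    then show False
      using geq w carZ by simp
  qed
  ultimately show thesis
    using \<phi> that by blast
qed

section \<open>The winding number cocycle of the circle\<close>

definition wrap :: "real \<Rightarrow> real^2" where
  "wrap t = (\<chi> i. if i = 1 then cos (2 * pi * t) else sin (2 * pi * t))"

lemma wrap_eq_iff: "wrap a = wrap b \<longleftrightarrow> a - b \<in> \<int>"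
proof -
  have "wrap a = wrap b \<longleftrightarrow>
      sin (2 * pi * a) = sin (2 * pi * b) \<and> cos (2 * pi * a) = cos (2 * pi * b)"
    by (auto simp: wrap_def vec_eq_iff forall_2)
  also have "\<dots> \<longleftrightarrow> (\<exists>m::int. 2 * pi * a = 2 * pi * b + 2 * pi * m)"
    by (rule sin_cos_eq_iff)
  also have "\<dots> \<longleftrightarrow> (\<exists>m::int. a - b = m)"
    by (simp flip: distrib_left add: diff_eq_eq add.commute)
  finally show ?thesis
    by (auto simp: Ints_def)
qed

lemma norm_vec2_1: "norm (u::real^2) = 1 \<longleftrightarrow> (u$1)\<^sup>2 + (u$2)\<^sup>2 = 1"
  by (simp add: norm_eq_1 inner_vec_def sum_2 power2_eq_square)

lemma wrap_mem_sphere: "wrap t \<in> sphere 0 1"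
  by (simp add: norm_vec2_1 wrap_def)

lemma continuous_map_wrap: "continuous_map euclideanreal circle wrap"
proof -
  have "continuous_on UNIV wrap"
    unfolding wrap_def
    by (rule continuous_on_vec_lambda, rename_tac i, case_tac "i = 1") (auto intro!: continuous_intros)
  then show ?thesis
    using wrap_mem_sphere by (auto simp: circle_def continuous_map_in_subtopology)
qed

lemma circle_subset_range_wrap:
  assumes "u \<in> sphere 0 1" obtains t where "wrap t = u"
proof -
  obtain s where "u$1 = cos s" "u$2 = sin s"
    using assms sincos_total_2pi [of "u$1" "u$2"] by (auto simp: norm_vec2_1)
  then have "wrap (s / (2 * pi)) = u"
    by (simp add: wrap_def vec_eq_iff forall_2)
  with that show thesis by blast
qed

definition is_lift :: "nat \<Rightarrow> ((nat \<Rightarrow> real) \<Rightarrow> real^2) \<Rightarrow> ((nat \<Rightarrow> real) \<Rightarrow> real) \<Rightarrow> bool" where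
  "is_lift p \<sigma> g \<longleftrightarrow>
     continuous_map (subtopology (powertop_real UNIV) (standard_simplex p)) euclideanreal g \<and>
     (\<forall>x\<in>standard_simplex p. wrap (g x) = \<sigma> x)"

lemma continuous_map_simplical_face:
  "continuous_map (powertop_real UNIV) (powertop_real UNIV) (simplical_face k)"
  unfolding continuous_map_componentwise
proof (intro conjI allI ballI)
  fix i
  show "continuous_map (powertop_real UNIV) euclideanreal (\<lambda>x. simplical_face k x i)"
    by (cases "i < k"; cases "i = k")
       (auto simp: simplical_face_def intro: continuous_map_product_projection)
qed auto

lemma is_lift_face:
  assumes "is_lift (Suc p) \<sigma> g" "k \<le> Suc p"
  shows "is_lift p (singular_face (Suc p) k \<sigma>) (g \<circ> simplical_face k)"
proof -
  have face: "simplical_face k x \<in> standard_simplex (Suc p)" if "x \<in> standard_simplex p" for x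
    using simplical_face_in_standard_simplex [of "Suc p" k x] assms that by simp
  then have "continuous_map (subtopology (powertop_real UNIV) (standard_simplex p))
      (subtopology (powertop_real UNIV) (standard_simplex (Suc p))) (simplical_face k)"
    by (auto simp: continuous_map_in_subtopology continuous_map_simplical_face
        intro: continuous_map_from_subtopology)
  with assms face show ?thesis
    by (auto simp: is_lift_def singular_face_def intro: continuous_map_compose)
qed

definition vertex :: "nat \<Rightarrow> nat \<Rightarrow> real" where
  "vertex i = (\<lambda>j. if j = i then 1 else 0)"

lemma simplical_face_vertex:
  "simplical_face k (vertex i) = vertex (if i < k then i else Suc i)"
  by (auto simp: simplical_face_def vertex_def fun_eq_iff)

lemma vertex_mem [simp]: "vertex i \<in> standard_simplex p \<longleftrightarrow> i \<le> p"
  by (simp add: vertex_def)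

text \<open>The difference of two lifts is a continuous integer-valued function on a connected space.\<close>

lemma lift_unique_up_to_constant:
  assumes "is_lift p \<sigma> g" "is_lift p \<sigma> h" "x \<in> standard_simplex p" "y \<in> standard_simplex p"
  shows "g x - h x = g y - h y"
proof -
  let ?D = "subtopology (powertop_real UNIV) (standard_simplex p)"
  let ?d = "\<lambda>x. g x - h x"
  have "continuous_map ?D euclideanreal ?d"
    using assms by (auto simp: is_lift_def intro: continuous_map_diff)
  moreover have "connectedin ?D (standard_simplex p)"
    by (simp add: connectedin_subtopology connectedin_standard_simplex)
  ultimately have conn: "connected (?d ` standard_simplex p)"
    using connectedin_continuous_map_image by fastforce
  have ints: "?d x \<in> \<int>" if "x \<in> standard_simplex p" for x
  proof -
    have "wrap (g x) = wrap (h x)"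
      using assms(1,2) that by (simp add: is_lift_def)
    then show ?thesis by (simp add: wrap_eq_iff)
  qed
  have "\<not> a < b" if ab: "a \<in> ?d ` standard_simplex p" "b \<in> ?d ` standard_simplex p" for a b
  proof
    assume "a < b"
    have "a \<in> \<int>" "b \<in> \<int>"
      using ab ints by auto
    then obtain m n where mn: "a = of_int m" "b = of_int n"
      unfolding Ints_def by blast
    with \<open>a < b\<close> have "m + 1 \<le> n" by simp
    then have "real_of_int (m + 1) \<le> real_of_int n"
      by (simp only: of_int_le_iff)
    \<comment> \<open>a connected set of integers with two elements would contain a half-integer\<close>
    then have "a + 1/2 \<in> {a..b}"
      unfolding mn by simp
    then have "a + 1/2 \<in> ?d ` standard_simplex p"
      using connected_contains_Icc [OF conn ab] by blast
    then have "a + 1/2 \<in> \<int>"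
      using ints by auto
    then obtain k where "a + 1/2 = real_of_int k"
      unfolding Ints_def by blast
    then have "real_of_int (2 * m + 1) = real_of_int (2 * k)"
      unfolding mn by simp
    then have "2 * m + 1 = 2 * k"
      by (simp only: of_int_eq_iff)
    then show False by presburger
  qed
  with assms(3,4) show ?thesis
    by (meson imageI linorder_neq_iff)
qed

text \<open>An arbitrary section of \<open>wrap\<close>, necessarily discontinuous. It serves to correct the
endpoints of a lift so that paths which are not closed also have an integral winding number.\<close>

definition turn :: "real^2 \<Rightarrow> real" where
  "turn u = (SOME t. wrap t = u)"

lemma wrap_turn: "u \<in> sphere 0 1 \<Longrightarrow> wrap (turn u) = u"
  unfolding turn_def by (rule someI_ex) (use circle_subset_range_wrap in blast)

text \<open>In complex notation a lift is the imaginary part of a logarithm, which exists on a contractible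
domain. The existence theorem is about subsets of normed spaces, so the simplex in \<open>nat \<Rightarrow>
real\<close> is first identified with a convex subset of the plane.\<close>

lemma singular_2_simplex_has_lift:
  assumes \<sigma>: "singular_simplex 2 circle \<sigma>"
  obtains g where "is_lift 2 \<sigma> g"
proof -
  let ?D = "subtopology (powertop_real UNIV) (standard_simplex 2)"
  define r :: "(nat \<Rightarrow> real) \<Rightarrow> real \<times> real" where "r x = (x 1, x 2)" for x
  define q :: "real \<times> real \<Rightarrow> nat \<Rightarrow> real" where
    "q z = (\<lambda>i. if i = 0 then 1 - fst z - snd z else if i = 1 then fst z
                 else if i = 2 then snd z else 0)" for z
  define T where "T = r ` standard_simplex 2"
  have qr: "q (r x) = x" if "x \<in> standard_simplex 2" for x
  proof -
    have "x 0 + x 1 + x 2 = 1" "\<forall>i>2. x i = 0"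
      using that by (auto simp: standard_simplex_def eval_nat_numeral)
    then show ?thesis
      by (auto simp: q_def r_def fun_eq_iff)
  qed
  have q_mem: "q z \<in> standard_simplex 2" if "z \<in> T" for z
    using that qr by (auto simp: T_def)
  have "convex T"
    unfolding convex_alt
  proof (intro ballI allI impI)
    fix a b and u :: real
    assume "a \<in> T" "b \<in> T" and u: "0 \<le> u \<and> u \<le> 1"
    then obtain x y where "a = r x" "b = r y" "x \<in> standard_simplex 2" "y \<in> standard_simplex 2"
      by (auto simp: T_def)
    then have "(1 - u) *\<^sub>R a + u *\<^sub>R b = r (\<lambda>i. (1 - u) * x i + u * y i)"
        "(\<lambda>i. (1 - u) * x i + u * y i) \<in> standard_simplex 2"
      using u by (auto simp: r_def convex_standard_simplex)
    then show "(1 - u) *\<^sub>R a + u *\<^sub>R b \<in> T"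
      by (auto simp: T_def)
  qed
  have cont_q: "continuous_map (top_of_set T) ?D q"
  proof -
    have "continuous_on T (\<lambda>z. q z i)" for i
      by (cases "i = 0"; cases "i = 1"; cases "i = 2") (auto simp: q_def intro!: continuous_intros)
    then show ?thesis
      using q_mem by (auto simp: continuous_map_in_subtopology continuous_map_componentwise)
  qed
  have \<sigma>_cont: "continuous_map ?D circle \<sigma>"
    using \<sigma> by (simp add: singular_simplex_def)
  then have "continuous_map (top_of_set T) circle (\<sigma> \<circ> q)"
    by (rule continuous_map_compose [OF cont_q])
  then have cont: "continuous_on T (\<lambda>z. \<sigma> (q z))"
    by (auto simp: circle_def continuous_map_in_subtopology o_def)
  define F where "F z = Complex (\<sigma> (q z) $ 1) (\<sigma> (q z) $ 2)" for z
  have "continuous_on T F"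
    unfolding F_def by (intro continuous_intros cont)
  have normF: "norm (F z) = 1" if "z \<in> T" for z
  proof -
    have "\<sigma> (q z) \<in> sphere 0 1"
      using \<sigma>_cont q_mem [OF that] by (auto simp: circle_def continuous_map_def Pi_iff)
    then show ?thesis
      by (simp add: F_def norm_vec2_1 cmod_def)
  qed
  have "F z \<noteq> 0" if "z \<in> T" for z
    using normF [OF that] by auto
  with \<open>continuous_on T F\<close> obtain g where g: "continuous_on T g" "\<And>z. z \<in> T \<Longrightarrow> F z = exp (g z)"
    using continuous_logarithm_on_contractible [of T F] convex_imp_contractible [OF \<open>convex T\<close>]
    by blast
  define h where "h x = Im (g (r x)) / (2 * pi)" for x
  have "wrap (h x) = \<sigma> x" if x: "x \<in> standard_simplex 2" for x
  proof -
    have rT: "r x \<in> T" using x by (simp add: T_def)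
    have "Re (g (r x)) = 0"
      using normF [OF rT] g(2) [OF rT] by simp
    then have "Re (F (r x)) = cos (Im (g (r x)))" "Im (F (r x)) = sin (Im (g (r x)))"
      using g(2) [OF rT] by (simp_all add: Re_exp Im_exp)
    then show ?thesis
      using qr [OF x] by (simp add: F_def h_def wrap_def vec_eq_iff forall_2)
  qed
  moreover have "continuous_map ?D euclideanreal h"
  proof -
    have "continuous_map ?D euclidean r"
      unfolding r_def prod_topology_euclidean [symmetric] continuous_map_pairwise
      by (auto simp: o_def intro: continuous_map_from_subtopology continuous_map_product_projection)
    then have "continuous_map ?D (top_of_set T) r"
      by (auto simp: continuous_map_in_subtopology T_def)
    moreover have "continuous_map (top_of_set T) euclideanreal (\<lambda>z. Im (g z) / (2 * pi))"
      using g(1) by (auto intro!: continuous_intros)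
    ultimately have "continuous_map ?D euclideanreal ((\<lambda>z. Im (g z) / (2 * pi)) \<circ> r)"
      by (rule continuous_map_compose)
    then show ?thesis
      by (simp add: o_def h_def [abs_def])
  qed
  ultimately show thesis
    using that by (auto simp: is_lift_def)
qed

text \<open>Both bracketed differences are integers for a lift \<open>g\<close>, hence taking the floor loses
nothing. The choice of \<open>g\<close> is immaterial by uniqueness of lifts.\<close>

definition winding :: "((nat \<Rightarrow> real) \<Rightarrow> real^2) \<Rightarrow> int" where
  "winding \<sigma> = (let g = SOME g. is_lift 1 \<sigma> g in
     \<lfloor>(g (vertex 1) - turn (\<sigma> (vertex 1))) - (g (vertex 0) - turn (\<sigma> (vertex 0)))\<rfloor>)"

lemma winding_eq:
  assumes g: "is_lift 1 \<sigma> g"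
  shows "real_of_int (winding \<sigma>) =
    (g (vertex 1) - turn (\<sigma> (vertex 1))) - (g (vertex 0) - turn (\<sigma> (vertex 0)))"
proof -
  define h where "h = (SOME g. is_lift 1 \<sigma> g)"
  have h: "is_lift 1 \<sigma> h"
    unfolding h_def by (rule someI [of "is_lift 1 \<sigma>", OF g])
  have "h (vertex 1) - g (vertex 1) = h (vertex 0) - g (vertex 0)"
    by (rule lift_unique_up_to_constant [OF h g]) auto
  then have hg: "(h (vertex 1) - turn (\<sigma> (vertex 1))) - (h (vertex 0) - turn (\<sigma> (vertex 0)))
      = (g (vertex 1) - turn (\<sigma> (vertex 1))) - (g (vertex 0) - turn (\<sigma> (vertex 0)))"
    by simp
  have g_int: "g (vertex i) - turn (\<sigma> (vertex i)) \<in> \<int>" if "i \<le> 1" for i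
  proof -
    have "wrap (g (vertex i)) = \<sigma> (vertex i)"
      using g that by (simp add: is_lift_def)
    then have "wrap (g (vertex i)) = wrap (turn (\<sigma> (vertex i)))"
      using wrap_turn [OF wrap_mem_sphere, of "g (vertex i)"] by simp
    then show ?thesis by (simp add: wrap_eq_iff)
  qed
  have "(g (vertex 1) - turn (\<sigma> (vertex 1))) - (g (vertex 0) - turn (\<sigma> (vertex 0))) \<in> \<int>"
    by (intro Ints_diff [OF g_int g_int]) auto
  then show ?thesis
    unfolding winding_def Let_def h_def [symmetric] hg by (rule of_int_floor)
qed

text \<open>The faces inherit lifts from one lift of the \<open>2\<close>-simplex, and then the corrected end
values cancel in pairs.\<close>

lemma winding_boundary:
  assumes \<sigma>: "singular_simplex 2 circle \<sigma>"
  shows "winding (singular_face 2 0 \<sigma>) - winding (singular_face 2 1 \<sigma>)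
    + winding (singular_face 2 2 \<sigma>) = 0"
proof -
  obtain g where g: "is_lift 2 \<sigma> g"
    using singular_2_simplex_has_lift [OF \<sigma>] .
  have "is_lift 1 (singular_face 2 k \<sigma>) (g \<circ> simplical_face k)" if "k \<le> 2" for k
    using is_lift_face [of 1 \<sigma> g k] g that by (simp only: Suc_1)
  note w = winding_eq [OF this]
  have face: "singular_face 2 k \<sigma> (vertex i) = \<sigma> (vertex (if i < k then i else Suc i))"
    if "i \<le> 1" for i k
    using that by (simp add: singular_face_def simplical_face_vertex)
  have "real_of_int (winding (singular_face 2 0 \<sigma>) - winding (singular_face 2 1 \<sigma>)
    + winding (singular_face 2 2 \<sigma>)) = 0"
    using w [of 0] w [of 1] w [of 2]
    by (simp add: face simplical_face_vertex del: One_nat_def) (simp add: numeral_2_eq_2)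
  then show ?thesis by linarith
qed

text \<open>The parameter \<open>x 0\<close> runs from \<open>1\<close> to \<open>0\<close> along the standard
\<open>1\<close>-simplex, which is why the loop winds \<open>-1\<close> times. This orientation is the one
that occurs on the edges of the torus cycle below.\<close>

definition loop_simplex :: "(nat \<Rightarrow> real) \<Rightarrow> real^2" where
  "loop_simplex = (\<lambda>x\<in>standard_simplex 1. wrap (x 0))"

lemma winding_loop: "winding loop_simplex = - 1"
proof -
  have "is_lift 1 loop_simplex (\<lambda>x. x 0)"
    by (auto simp: is_lift_def loop_simplex_def
        intro!: continuous_map_from_subtopology continuous_map_product_projection)
  from winding_eq [OF this] have "real_of_int (winding loop_simplex) =
     - 1 + (turn (wrap 1) - turn (wrap 0))"
    by (simp add: loop_simplex_def) (simp add: vertex_def)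
  also have "wrap 1 = wrap 0"
    by (simp add: wrap_eq_iff)
  finally show ?thesis by simp
qed

definition winding_cochain :: "(real^2) cochain" where
  "winding_cochain = (\<lambda>c\<in>singular_chain_set 1 circle. frag_eval winding c)"

lemma winding_cocycle: "winding_cochain \<in> cocycles 1 circle"
proof -
  have "frag_eval winding (chain_boundary 2 c) = 0" if "singular_chain 2 circle c" for c
    using that unfolding singular_chain_def
  proof (induction c rule: frag_induction)
    case (one \<sigma>)
    then have "winding (singular_face 2 0 \<sigma>) - winding (singular_face 2 1 \<sigma>)
      + winding (singular_face 2 2 \<sigma>) = 0"
      using winding_boundary by blast
    then show ?case
      by (simp add: chain_boundary_of eval_nat_numeral frag_eval_add frag_eval_diff frag_eval_minus)
  qed (simp_all add: chain_boundary_diff frag_eval_diff)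
  moreover have "winding_cochain \<in> carrier (cochain_group 1 circle)"
    unfolding cochain_iff by (auto simp: winding_cochain_def frag_eval_add singular_chain_add)
  ultimately show ?thesis
    by (auto simp: cocycles_def kernel_def coboundary_def winding_cochain_def numeral_2_eq_2
        singular_chain_boundary_alt simp del: cochain_group_simps(1))
qed

lemma singular_loop: "singular_simplex 1 circle loop_simplex"
proof -
  have "continuous_map (subtopology (powertop_real UNIV) (standard_simplex 1)) circle (\<lambda>x. wrap (x 0))"
    by (rule continuous_map_compose [OF _ continuous_map_wrap, unfolded o_def])
       (auto intro!: continuous_map_from_subtopology continuous_map_product_projection)
  then have "continuous_map (subtopology (powertop_real UNIV) (standard_simplex 1)) circle loop_simplex"
    by (rule continuous_map_eq) (simp add: loop_simplex_def)
  then show ?thesis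
    by (simp add: singular_simplex_def loop_simplex_def)
qed

lemma loop_is_cycle: "chain_boundary 1 (frag_of loop_simplex) = 0"
proof -
  have "wrap 1 = wrap 0" by (simp add: wrap_eq_iff)
  moreover have "loop_simplex (vertex i) = wrap (vertex i 0)" if "i \<le> 1" for i
    using that by (simp add: loop_simplex_def)
  moreover have "vertex 0 0 = 1" "vertex 1 0 = 0"
    by (simp_all add: vertex_def)
  ultimately have "loop_simplex (vertex 0) = loop_simplex (vertex 1)"
    by simp
  moreover have "standard_simplex 0 = {vertex 0}"
    by (simp add: standard_simplex_0 vertex_def)
  ultimately have "singular_face 1 0 loop_simplex = singular_face 1 1 loop_simplex"
    by (auto simp: singular_face_def simplical_face_vertex)
  then show ?thesis
    by (simp add: chain_boundary_of)
qed

lemma circle_generator_nonzero_on_loop: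
  assumes "circle_generator A"
  obtains \<phi> where "\<phi> \<in> A" "\<phi> \<in> cocycles 1 circle" "\<phi> (frag_of loop_simplex) \<noteq> 0"
proof -
  have "winding_cochain (frag_of loop_simplex) \<noteq> 0"
    using singular_loop by (simp add: winding_cochain_def singular_chain_of winding_loop)
  then show thesis
    using generator_nonzero_on_cycle [of 0 circle A winding_cochain "frag_of loop_simplex"] that assms
      winding_cocycle singular_loop loop_is_cycle
    by (auto simp: circle_generator_def singular_chain_of)
qed

section \<open>Evaluating products of degree-one cochains on a simplex\<close>

text \<open>The point with barycentric parameter \<open>y\<close> on the edge between the vertices
\<open>i\<close> and \<open>i + 1\<close>.\<close>

definition edge_point :: "nat \<Rightarrow> (nat \<Rightarrow> real) \<Rightarrow> nat \<Rightarrow> real" where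
  "edge_point i y = (\<lambda>m. if m = i then y 0 else if m = Suc i then y 1 else 0)"

definition edge_simplex :: "nat \<Rightarrow> ((nat \<Rightarrow> real) \<Rightarrow> 'a) \<Rightarrow> (nat \<Rightarrow> real) \<Rightarrow> 'a" where
  "edge_simplex i \<sigma> = (\<lambda>y\<in>standard_simplex 1. \<sigma> (edge_point i y))"

lemma standard_simplex_1D:
  assumes "y \<in> standard_simplex 1"
  shows "y 0 + y 1 = 1" "0 \<le> y i" "y i \<le> 1" "m > 1 \<Longrightarrow> y m = 0"
  using assms by (auto simp: standard_simplex_def)

lemma sum_edge_point:
  "(\<Sum>m\<le>j. edge_point i y m) = (if j < i then 0 else if j = i then y 0 else y 0 + y 1)"
  by (induction j) (auto simp: edge_point_def)

lemma edge_point_mem: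
  assumes "y \<in> standard_simplex 1" "i < k"
  shows "edge_point i y \<in> standard_simplex k"
proof -
  have "(\<Sum>m\<le>k. edge_point i y m) = 1"
    using assms standard_simplex_1D(1) [OF assms(1)] by (simp add: sum_edge_point)
  moreover have "0 \<le> edge_point i y m \<and> edge_point i y m \<le> 1" for m
    using standard_simplex_1D [OF assms(1)] by (simp add: edge_point_def)
  moreover have "edge_point i y m = 0" if "m > k" for m
    using that assms(2) by (simp add: edge_point_def)
  ultimately show ?thesis
    by (simp add: standard_simplex_def)
qed

lemma edge_point_0:
  assumes "y \<in> standard_simplex 1" shows "edge_point 0 y = y"
  using standard_simplex_1D(4) [OF assms] by (auto simp: edge_point_def fun_eq_iff)

lemma singular_simplex_reparametrize:
  assumes \<sigma>: "singular_simplex k X \<sigma>"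
    and r: "\<And>y. y \<in> standard_simplex q \<Longrightarrow> r y \<in> standard_simplex k"
    and comp: "\<And>m. continuous_map (powertop_real UNIV) euclideanreal (\<lambda>y. r y m)"
  shows "singular_simplex q X (\<lambda>y\<in>standard_simplex q. \<sigma> (r y))"
proof -
  let ?D = "\<lambda>p. subtopology (powertop_real UNIV) (standard_simplex p)"
  have "continuous_map (powertop_real UNIV) (powertop_real UNIV) r"
    using comp by (auto simp: continuous_map_componentwise)
  then have "continuous_map (?D q) (?D k) r"
    using r by (auto simp: continuous_map_in_subtopology intro: continuous_map_from_subtopology)
  then have "continuous_map (?D q) X (\<sigma> \<circ> r)"
    using \<sigma> by (auto simp: singular_simplex_def intro: continuous_map_compose)
  then have "continuous_map (?D q) X (\<lambda>y\<in>standard_simplex q. \<sigma> (r y))"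
    by (rule continuous_map_eq) auto
  then show ?thesis
    by (simp add: singular_simplex_def)
qed

lemma singular_simplex_edge:
  assumes "singular_simplex k X \<sigma>" "i < k"
  shows "singular_simplex 1 X (edge_simplex i \<sigma>)"
  unfolding edge_simplex_def
proof (rule singular_simplex_reparametrize [OF assms(1)])
  show "continuous_map (powertop_real UNIV) euclideanreal (\<lambda>y. edge_point i y m)" for m
    by (cases "m = i"; cases "m = Suc i")
       (auto simp: edge_point_def intro: continuous_map_product_projection)
qed (use assms(2) edge_point_mem in blast)

lemma back_face_point_mem:
  assumes "y \<in> standard_simplex q"
  shows "(\<lambda>m. if m < 1 then 0 else y (m - 1)) \<in> standard_simplex (Suc q)"
  using simplical_face_in_standard_simplex [of "Suc q" 0 y] assms
  by (auto simp: simplical_face_def elim!: back_subst [where P = "\<lambda>z. z \<in> _"])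

lemma singular_simplex_back_face:
  assumes "singular_simplex (Suc q) X \<sigma>"
  shows "singular_simplex q X (back_face 1 q \<sigma>)"
  unfolding back_face_def
proof (rule singular_simplex_reparametrize [OF assms])
  show "continuous_map (powertop_real UNIV) euclideanreal
      (\<lambda>y. if m < 1 then 0 else y (m - 1))" for m
    by (cases "m < 1") (auto intro: continuous_map_product_projection)
qed (use back_face_point_mem in blast)

lemma edge_back_face:
  assumes "i < q"
  shows "edge_simplex i (back_face 1 q \<sigma>) = edge_simplex (Suc i) \<sigma>"
proof -
  have "(\<lambda>m. if m < 1 then 0 else edge_point i y (m - 1)) = edge_point (Suc i) y" for y
    by (auto simp: edge_point_def fun_eq_iff)
  then show ?thesis
    using edge_point_mem [OF _ assms]
    by (auto simp: edge_simplex_def back_face_def fun_eq_iff simp del: One_nat_def)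
qed

lemma front_face_eq_edge: "front_face 1 \<sigma> = edge_simplex 0 \<sigma>"
  by (auto simp: front_face_def edge_simplex_def edge_point_0 fun_eq_iff simp del: One_nat_def)

text \<open>The cochain that \<open>wedge\<close> produces from fixed representatives of its factors.\<close>

primrec cup_list :: "'a topology \<Rightarrow> 'a cochain list \<Rightarrow> 'a cochain" where
  "cup_list X [] = (\<lambda>c\<in>carrier (chain_group 0 X). \<Sum>\<sigma>\<in>Poly_Mapping.keys c. Poly_Mapping.lookup c \<sigma>)"
| "cup_list X (\<phi> # \<phi>s) = cup_cochain 1 (length \<phi>s) X \<phi> (cup_list X \<phi>s)"

lemma cup_list_extends_linearly:
  obtains g where "\<And>c. singular_chain (length \<phi>s) X c \<Longrightarrow> cup_list X \<phi>s c = frag_eval g c"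
proof (cases \<phi>s)
  case Nil
  then have "cup_list X \<phi>s c = frag_eval (\<lambda>_. 1) c" if "singular_chain (length \<phi>s) X c" for c
    using that by (simp add: frag_eval_def)
  then show thesis using that by blast
next
  case (Cons \<phi> \<psi>s)
  then have "cup_list X \<phi>s c = frag_eval (\<lambda>\<sigma>. \<phi> (frag_of (front_face 1 \<sigma>))
      * cup_list X \<psi>s (frag_of (back_face 1 (length \<psi>s) \<sigma>))) c"
    if "singular_chain (length \<phi>s) X c" for c
    using that by (simp add: frag_eval_def cup_cochain_def)
  then show thesis using that by blast
qed

text \<open>Iterating the Alexander-Whitney formula peels off the first edge of the simplex at each
step.\<close>

lemma cup_list_simplex:
  "singular_simplex (length \<phi>s) X \<sigma> \<Longrightarrow>
    cup_list X \<phi>s (frag_of \<sigma>) = (\<Prod>i<length \<phi>s. (\<phi>s ! i) (frag_of (edge_simplex i \<sigma>)))"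
proof (induction \<phi>s arbitrary: \<sigma>)
  case Nil
  then show ?case by (simp add: singular_chain_of)
next
  case (Cons \<phi> \<phi>s)
  let ?q = "length \<phi>s"
  have \<sigma>: "singular_simplex (Suc ?q) X \<sigma>" using Cons.prems by simp
  have "cup_list X (\<phi> # \<phi>s) (frag_of \<sigma>) =
      \<phi> (frag_of (edge_simplex 0 \<sigma>)) * cup_list X \<phi>s (frag_of (back_face 1 ?q \<sigma>))"
    using \<sigma> by (simp add: cup_cochain_def singular_chain_of flip: front_face_eq_edge)
  also have "cup_list X \<phi>s (frag_of (back_face 1 ?q \<sigma>)) =
      (\<Prod>i<?q. (\<phi>s ! i) (frag_of (edge_simplex (Suc i) \<sigma>)))"
    using Cons.IH [OF singular_simplex_back_face [OF \<sigma>]] by (simp add: edge_back_face del: One_nat_def)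
  finally show ?case
    by (simp add: prod.lessThan_Suc_shift del: cup_list.simps prod.lessThan_Suc)
qed

lemma cup_list_mem_wedge:
  assumes "list_all2 (\<lambda>\<phi> A. \<phi> \<in> A) \<phi>s As"
  shows "cup_list X \<phi>s \<in> wedge X As"
  using assms
proof (induction rule: list_all2_induct)
  case Nil
  have "cup_list X [] \<in> extensional (singular_chain_set 0 X)" by simp
  from mem_cohomology_class [OF this] show ?case
    by (simp only: wedge.simps unit_class_def cup_list.simps)
next
  case (Cons \<phi> \<phi>s A As)
  then have len: "length \<phi>s = length As"
    by (simp add: list_all2_lengthD)
  have "cup_list X (\<phi> # \<phi>s) \<in> extensional (singular_chain_set (1 + length As) X)"
    by (simp add: cup_cochain_def len)
  from mem_cohomology_class [OF this] show ?case
    using Cons len by (auto simp: cup_def)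
qed

lemma cochain_map_mem_cohomology_induced:
  assumes "\<phi> \<in> A" shows "cochain_map p X f \<phi> \<in> cohomology_induced p X f A"
  using assms mem_cohomology_class [of "cochain_map p X f \<phi>" p X]
  by (auto simp: cohomology_induced_def cochain_map_def)

section \<open>A fundamental cycle of the torus\<close>

lemma sum_simplical_face:
  "(\<Sum>m\<le>i. simplical_face j x m) = (if i < j then \<Sum>m\<le>i. x m else \<Sum>m<i. x m)"
  for x :: "nat \<Rightarrow> real"
proof (induction i)
  case (Suc i)
  consider "Suc i < j" | "Suc i = j" | "j < Suc i" by linarith
  then show ?case
    by cases (use Suc in \<open>simp_all add: simplical_face_def lessThan_Suc_atMost [symmetric]\<close>)
qed (auto simp: simplical_face_def)

text \<open>The partial sums \<open>\<Sum>m\<le>j. x m\<close> increase with \<open>j\<close> and lie between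
\<open>0\<close> and \<open>1\<close>, so they identify the standard simplex with the ordered simplex
\<open>t\<^sub>0 \<le> t\<^sub>1 \<le> \<dots>\<close> of the unit cube. When \<open>f\<close> is a bijection
from the coordinates \<open>E\<close> to the indices below \<open>k\<close>, this is one of the simplices into
which the cube is cut, mapped to the torus.\<close>

definition staircase :: "nat \<Rightarrow> 'e set \<Rightarrow> ('e \<Rightarrow> nat) \<Rightarrow> (nat \<Rightarrow> real) \<Rightarrow> 'e \<Rightarrow> real^2" where
  "staircase k E f = (\<lambda>x\<in>standard_simplex k. \<lambda>e\<in>E. wrap (\<Sum>m\<le>f e. x m))"

lemma singular_simplex_staircase:
  "singular_simplex k (product_topology (\<lambda>e. circle) E) (staircase k E f)"
proof -
  let ?D = "subtopology (powertop_real UNIV) (standard_simplex k)"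
  have "continuous_map ?D circle (\<lambda>x. wrap (\<Sum>m\<le>f e. x m))" for e
    by (rule continuous_map_compose [OF _ continuous_map_wrap, unfolded o_def])
       (auto intro!: continuous_map_sum continuous_map_from_subtopology continuous_map_product_projection)
  then have "continuous_map ?D (product_topology (\<lambda>e. circle) E)
      (\<lambda>x. \<lambda>e\<in>E. wrap (\<Sum>m\<le>f e. x m))"
    by (auto simp: continuous_map_componentwise)
  then have "continuous_map ?D (product_topology (\<lambda>e. circle) E) (staircase k E f)"
    by (rule continuous_map_eq) (simp add: staircase_def)
  then show ?thesis
    by (simp add: singular_simplex_def staircase_def)
qed

lemma singular_face_staircase:
  assumes "0 < k" "j \<le> k"
  shows "singular_face k j (staircase k E f) = (\<lambda>x\<in>standard_simplex (k - 1).
     \<lambda>e\<in>E. wrap (if f e < j then \<Sum>m\<le>f e. x m else \<Sum>m<f e. x m))"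
  using assms
  by (auto simp: staircase_def singular_face_def simplical_face_in_standard_simplex sum_simplical_face
      fun_eq_iff)

text \<open>On the face opposite to an inner vertex \<open>j\<close> the partial sums with indices \<open>j -
1\<close> and \<open>j\<close> agree, so exchanging the two coordinates that use them has no effect.\<close>

lemma inner_face_staircase:
  assumes "0 < j" "j < k"
  shows "singular_face k j (staircase k E (Transposition.transpose (j - 1) j \<circ> f))
    = singular_face k j (staircase k E f)"
proof -
  have below: "{..j - 1} = {..<j}" using assms(1) by auto
  have "(if Transposition.transpose (j - 1) j i < j then \<Sum>m\<le>Transposition.transpose (j - 1) j i. x m
      else \<Sum>m<Transposition.transpose (j - 1) j i. x m) = (if i < j then \<Sum>m\<le>i. x m else \<Sum>m<i. x m)"
    for i and x :: "nat \<Rightarrow> real"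
  proof -
    consider "i = j - 1" | "i = j" | "i \<noteq> j - 1" "i \<noteq> j" by blast
    then show ?thesis
    proof cases
      case 1
      then show ?thesis using assms(1) below by simp
    next
      case 2
      then show ?thesis using assms(1) below by simp
    next
      case 3
      then show ?thesis by simp
    qed
  qed
  then show ?thesis
    using assms by (simp add: singular_face_staircase cong: if_cong del: One_nat_def)
qed

definition cyclic_shift :: "nat \<Rightarrow> nat \<Rightarrow> nat" where
  "cyclic_shift n i = (if i = 0 then n else if i \<le> n then i - 1 else i)"

lemma cyclic_shift_permutes_and_sign:
  "cyclic_shift n permutes {..n} \<and> sign (cyclic_shift n) = (- 1) ^ n"
proof (induction n)
  case 0
  have "cyclic_shift 0 = id" by (auto simp: cyclic_shift_def fun_eq_iff)
  show ?case unfolding \<open>cyclic_shift 0 = id\<close> by (simp only: permutes_id sign_id power_0 simp_thms)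
next
  case (Suc n)
  \<comment> \<open>the sign follows by building the cycle one transposition at a time\<close>
  have eq: "cyclic_shift (Suc n) = Transposition.transpose n (Suc n) \<circ> cyclic_shift n"
    by (auto simp: cyclic_shift_def Transposition.transpose_def fun_eq_iff)
  have shift: "cyclic_shift n permutes {..Suc n}"
    using Suc permutes_subset by (metis atMost_subset_iff le_SucI order_refl)
  have swap: "Transposition.transpose n (Suc n) permutes {..Suc n}"
    by (rule permutes_swap_id) auto
  have "sign (cyclic_shift (Suc n)) = sign (Transposition.transpose n (Suc n)) * sign (cyclic_shift n)"
    unfolding eq using shift swap
    by (intro sign_compose) (auto intro: permutes_imp_permutation [of "{..Suc n}"])
  then show ?case
    using Suc permutes_compose [OF shift swap] unfolding eq [symmetric] by (simp add: sign_swap_id)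
qed

text \<open>On the last face the partial sum with index \<open>k - 1\<close> is \<open>1\<close>; on face
\<open>0\<close> the one with index \<open>0\<close> is \<open>0\<close>. These are the same point of the
circle, and all other coordinates agree after the shift of indices.\<close>

lemma outer_face_staircase:
  assumes "0 < k" "\<And>e. e \<in> E \<Longrightarrow> f e < k"
  shows "singular_face k k (staircase k E (cyclic_shift (k - 1) \<circ> f))
    = singular_face k 0 (staircase k E f)"
proof -
  have "wrap (\<Sum>m\<le>cyclic_shift (k - 1) (f e). x m) = wrap (\<Sum>m<f e. x m)"
    if "e \<in> E" "x \<in> standard_simplex (k - 1)" for e and x
  proof (cases "f e = 0")
    case True
    have "wrap 1 = wrap 0" by (simp add: wrap_eq_iff)
    with True that show ?thesis by (simp add: cyclic_shift_def standard_simplex_def)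
  next
    case False
    then have "{..f e - 1} = {..<f e}" by auto
    with False assms(2) [OF that(1)] show ?thesis by (simp add: cyclic_shift_def)
  qed
  moreover have "cyclic_shift (k - 1) (f e) < k" if "e \<in> E" for e
    using assms(2) [OF that] by (auto simp: cyclic_shift_def)
  ultimately show ?thesis
    using assms(1) by (auto simp: singular_face_staircase fun_eq_iff)
qed

definition torus_cycle :: "nat \<Rightarrow> 'e set \<Rightarrow> ('e \<Rightarrow> nat) \<Rightarrow> ('e \<Rightarrow> real^2) chain" where
  "torus_cycle k E idx =
     (\<Sum>p | p permutes {..<k}. frag_cmul (sign p) (frag_of (staircase k E (p \<circ> idx))))"

lemma singular_chain_torus_cycle:
  "singular_chain k (product_topology (\<lambda>e. circle) E) (torus_cycle k E idx)"
  unfolding torus_cycle_def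
  by (intro singular_chain_sum singular_chain_cmul) (simp add: singular_chain_of singular_simplex_staircase)

lemma sign_sum_compose:
  assumes c: "c permutes {..<k::nat}"
  shows "(\<Sum>p | p permutes {..<k}. frag_cmul (sign p) (F p)) =
    frag_cmul (sign c) (\<Sum>p | p permutes {..<k}. frag_cmul (sign p) (F (c \<circ> p)))"
proof -
  have perm: "permutation p" if "p permutes {..<k}" for p :: "nat \<Rightarrow> nat"
    using that by (rule permutes_imp_permutation [OF finite_lessThan])
  have "(\<Sum>p | p permutes {..<k}. frag_cmul (sign p) (F p)) =
      (\<Sum>p | p permutes {..<k}. frag_cmul (sign (c \<circ> p)) (F (c \<circ> p)))"
    by (rule setum_permutations_compose_left [OF c])
  also have "\<dots> = (\<Sum>p | p permutes {..<k}. frag_cmul (sign c) (frag_cmul (sign p) (F (c \<circ> p))))"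
    by (rule sum.cong) (auto simp: sign_compose perm [OF c] perm)
  finally show ?thesis
    by (simp add: frag_cmul_sum)
qed

text \<open>Collect the boundary by face number: \<open>S j\<close> is the signed sum of all
\<open>j\<close>-th faces. For an inner \<open>j\<close>, composing with a transposition gives \<open>S j = -
S j\<close>. The cyclic shift has sign \<open>(-1) ^ (k - 1)\<close> and relates \<open>S k\<close> to
\<open>S 0\<close>, and this cancels against the boundary sign \<open>(-1) ^ k\<close>.\<close>

lemma torus_cycle_is_cycle:
  assumes idx: "\<And>e. e \<in> E \<Longrightarrow> idx e < k"
  shows "chain_boundary k (torus_cycle k E idx) = 0"
proof (cases "k = 0")
  case True
  then show ?thesis by (simp add: chain_boundary_def)
next
  case False
  then have k: "0 < k" by simp
  define S where "S j = (\<Sum>p | p permutes {..<k}.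
      frag_cmul (sign p) (frag_of (singular_face k j (staircase k E (p \<circ> idx)))))" for j
  have "chain_boundary k (torus_cycle k E idx) =
      (\<Sum>p | p permutes {..<k}. \<Sum>j\<le>k. frag_cmul ((-1) ^ j)
        (frag_cmul (sign p) (frag_of (singular_face k j (staircase k E (p \<circ> idx))))))"
    using k by (simp add: torus_cycle_def chain_boundary_sum chain_boundary_cmul chain_boundary_of
        o_def frag_cmul_sum mult.commute)
  also have "\<dots> = (\<Sum>j\<le>k. frag_cmul ((-1) ^ j) (S j))"
    unfolding S_def frag_cmul_sum by (rule sum.swap)
  also have "\<dots> = (\<Sum>j\<in>{0, k}. frag_cmul ((-1) ^ j) (S j))"
  proof (rule sum.mono_neutral_right)
    \<comment> \<open>each inner sum equals its own negative, and the chain group has no torsion\<close>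
    show "\<forall>j\<in>{..k} - {0, k}. frag_cmul ((-1) ^ j) (S j) = 0"
    proof
      fix j assume "j \<in> {..k} - {0, k}"
      then have j: "0 < j" "j < k" by auto
      let ?t = "Transposition.transpose (j - 1) j"
      have t: "?t permutes {..<k}"
        using j by (intro permutes_swap_id) auto
      have "S j = frag_cmul (sign ?t) (\<Sum>p | p permutes {..<k}. frag_cmul (sign p)
          (frag_of (singular_face k j (staircase k E (?t \<circ> (p \<circ> idx))))))"
        unfolding S_def o_assoc by (rule sign_sum_compose [OF t])
      also have "\<dots> = frag_cmul (sign ?t) (S j)"
        unfolding inner_face_staircase [OF j] S_def ..
      also have "sign ?t = -1"
        using j by (simp add: sign_swap_id)
      finally have "S j = - S j"
        by simp
      then have "S j + S j = 0"
        by (simp add: eq_neg_iff_add_eq_0)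
      then have "frag_cmul 2 (S j) = 0"
        using frag_cmul_distrib [of 1 1 "S j"] by simp
      then show "frag_cmul ((-1) ^ j) (S j) = 0"
        by simp
    qed
  qed auto
  also have "\<dots> = S 0 + frag_cmul ((-1) ^ k) (S k)"
    using k by simp
  also have "\<dots> = 0"
  proof -
    have c: "cyclic_shift (k - 1) permutes {..<k}" and
        sgn: "sign (cyclic_shift (k - 1)) = (- 1) ^ (k - 1)"
      using cyclic_shift_permutes_and_sign [of "k - 1"] k
      by (simp_all flip: lessThan_Suc_atMost)
    have "p (idx e) < k" if "p permutes {..<k}" "e \<in> E" for p e
      using permutes_in_image [OF that(1), of "idx e"] idx [OF that(2)] by simp
    then have outer: "singular_face k k (staircase k E (cyclic_shift (k - 1) \<circ> (p \<circ> idx)))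
        = singular_face k 0 (staircase k E (p \<circ> idx))" if "p permutes {..<k}" for p
      using outer_face_staircase [of k E "p \<circ> idx"] k that by simp
    have "S k = frag_cmul ((-1) ^ (k - 1)) (\<Sum>p | p permutes {..<k}. frag_cmul (sign p)
        (frag_of (singular_face k k (staircase k E (cyclic_shift (k - 1) \<circ> (p \<circ> idx))))))"
      unfolding S_def o_assoc sgn [symmetric] by (rule sign_sum_compose [OF c])
    also have "\<dots> = frag_cmul ((-1) ^ (k - 1)) (S 0)"
      unfolding S_def using outer by (intro arg_cong [where f = "frag_cmul _"] sum.cong) auto
    finally have "S k = frag_cmul ((-1) ^ (k - 1)) (S 0)" .
    moreover have "(-1) ^ k * (-1) ^ (k - 1) = (-1::int)"
      using k by (cases k) (auto simp flip: power_add)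
    ultimately show ?thesis by simp
  qed
  finally show ?thesis .
qed

section \<open>The product class on the fundamental cycle\<close>

text \<open>All three faces of a constant \<open>2\<close>-simplex are the constant \<open>1\<close>-simplex,
which is therefore a boundary.\<close>

lemma cocycle_const:
  assumes \<phi>: "\<phi> \<in> cocycles 1 X" and u: "u \<in> topspace X"
  shows "\<phi> (frag_of (\<lambda>x\<in>standard_simplex 1. u)) = 0"
proof -
  let ?c = "\<lambda>p. \<lambda>x\<in>standard_simplex p. u"
  have sing: "singular_simplex p X (?c p)" for p
    using u continuous_map_eq [of _ X "\<lambda>x. u" "?c p"]
    by (auto simp: singular_simplex_def)
  have face: "singular_face 2 k (?c 2) = ?c 1" if "k \<le> 2" for k
    using that by (auto simp: singular_face_def simplical_face_in_standard_simplex fun_eq_iff)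
  have "chain_boundary 2 (frag_of (?c 2)) = frag_of (?c 1)"
    using face [of 0] face [of 1] face [of 2]
    by (simp add: chain_boundary_of eval_nat_numeral)
  moreover have "coboundary 1 X \<phi> (frag_of (?c 2)) = 0"
    using \<phi> sing [of 2] by (simp add: cocycles_def kernel_def singular_chain_of numeral_2_eq_2)
  ultimately show ?thesis
    using sing [of 2] by (simp add: coboundary_def singular_chain_of numeral_2_eq_2)
qed

text \<open>Between vertex \<open>i\<close> and vertex \<open>i + 1\<close> only the partial sum with index
\<open>i\<close> varies; the others are constantly \<open>0\<close> or \<open>1\<close>, hence give the base
point of the circle.\<close>

lemma edge_staircase_component:
  assumes "e \<in> E" "i < k"
  shows "simplex_map 1 (\<lambda>t. t e) (edge_simplex i (staircase k E f)) =
    (if f e = i then loop_simplex else (\<lambda>x\<in>standard_simplex 1. wrap 0))"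
proof -
  have "wrap 1 = wrap 0" by (simp add: wrap_eq_iff)
  then show ?thesis
    using assms edge_point_mem [OF _ assms(2)] standard_simplex_1D(1)
    by (auto simp: simplex_map_def edge_simplex_def staircase_def loop_simplex_def sum_edge_point fun_eq_iff
        simp del: One_nat_def)
qed

text \<open>The factor belonging to the coordinate \<open>es ! i\<close> is evaluated on the edge
\<open>i\<close>, along which that coordinate moves exactly when \<open>p\<close> fixes \<open>i\<close>. A
permutation other than the identity thus has a factor that is evaluated on a constant path and
vanishes.\<close>

lemma cup_list_torus_cycle:
  fixes es :: "'e list"
  assumes es: "distinct es" "set es = E"
    and idx: "\<And>i. i < length es \<Longrightarrow> idx (es ! i) = i"
    and \<phi>: "\<phi> \<in> cocycles 1 circle"
  defines "T \<equiv> product_topology (\<lambda>e. circle) E"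
  shows "cup_list T (map (\<lambda>e. cochain_map 1 T (\<lambda>t. t e) \<phi>) es) (torus_cycle (length es) E idx)
    = \<phi> (frag_of loop_simplex) ^ length es"
proof -
  let ?k = "length es"
  let ?\<phi>s = "map (\<lambda>e. cochain_map 1 T (\<lambda>t. t e) \<phi>) es"
  let ?P = "{p. p permutes {..<?k}}"
  have sing: "singular_simplex ?k T (staircase ?k E f)" for f
    unfolding T_def by (rule singular_simplex_staircase)
  have val: "cup_list T ?\<phi>s (frag_of (staircase ?k E (p \<circ> idx))) =
      (if p = id then \<phi> (frag_of loop_simplex) ^ ?k else 0)" if p: "p permutes {..<?k}" for p
  proof -
    have "\<phi> (frag_of (\<lambda>x\<in>standard_simplex 1. wrap 0)) = 0"
      by (rule cocycle_const [OF \<phi>]) (use wrap_mem_sphere in \<open>simp add: circle_def\<close>)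
    then have factor: "(?\<phi>s ! i) (frag_of (edge_simplex i (staircase ?k E (p \<circ> idx)))) =
        (if p i = i then \<phi> (frag_of loop_simplex) else 0)" if "i < ?k" for i
      using that es idx singular_simplex_edge [OF sing that]
      by (simp add: cochain_map_def singular_chain_of edge_staircase_component nth_mem [of i es, unfolded es]
          del: One_nat_def)
    have "cup_list T ?\<phi>s (frag_of (staircase ?k E (p \<circ> idx))) =
        (\<Prod>i<?k. if p i = i then \<phi> (frag_of loop_simplex) else 0)"
      using cup_list_simplex [of ?\<phi>s T "staircase ?k E (p \<circ> idx)"] sing factor by simp
    also have "\<dots> = (if p = id then \<phi> (frag_of loop_simplex) ^ ?k else 0)"
    proof (cases "p = id")
      case False
      then obtain i where "p i \<noteq> i" by (auto simp: fun_eq_iff)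
      moreover have "i < ?k" using p \<open>p i \<noteq> i\<close> by (auto simp: permutes_def)
      ultimately show ?thesis using False by (auto intro!: prod_zero)
    qed simp
    finally show ?thesis .
  qed
  obtain g where g: "\<And>c. singular_chain ?k T c \<Longrightarrow> cup_list T ?\<phi>s c = frag_eval g c"
    using cup_list_extends_linearly [of ?\<phi>s T] by auto
  have "cup_list T ?\<phi>s (torus_cycle ?k E idx) = frag_eval g (torus_cycle ?k E idx)"
    by (rule g) (simp add: T_def singular_chain_torus_cycle)
  also have "\<dots> = (\<Sum>p\<in>?P. sign p * cup_list T ?\<phi>s (frag_of (staircase ?k E (p \<circ> idx))))"
    using g sing by (simp add: torus_cycle_def frag_eval_sum frag_eval_cmul singular_chain_of)
  also have "\<dots> = (\<Sum>p\<in>?P. if p = id then \<phi> (frag_of loop_simplex) ^ ?k else 0)"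
  proof (intro sum.cong refl)
    fix p assume "p \<in> ?P"
    then show "sign p * cup_list T ?\<phi>s (frag_of (staircase ?k E (p \<circ> idx))) =
        (if p = id then \<phi> (frag_of loop_simplex) ^ ?k else 0)"
      by (subst val) auto
  qed
  also have "\<dots> = \<phi> (frag_of loop_simplex) ^ ?k"
    by (simp add: finite_permutations permutes_id)
  finally show ?thesis .
qed

section \<open>Independent spinning detects the angle class\<close>

theorem proposition5:
  fixes n :: nat and r :: real and G :: "nat pair_pre_digraph"
    and es :: "(nat \<times> nat) list" and d\<theta> :: "(real^2) cochain set"
  assumes "pair_loopfree_digraph G" and "pverts G = {1..n}"
    and "distinct es" and "set es = parcs G"
    and "circle_generator d\<theta>"
    and "r > 0"
    and "spins_independently n G r"
  shows "angle_class n G es d\<theta> \<notin>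
    kernel (cohomology_group (card (parcs G)) (Conf n))
           (cohomology_group (card (parcs G)) (Conf_r n r))
           (cohomology_induced (card (parcs G)) (Conf_r n r) conf_inclusion)"
proof
  let ?k = "card (parcs G)" and ?T = "torus G"
  assume "angle_class n G es d\<theta> \<in>
    kernel (cohomology_group ?k (Conf n)) (cohomology_group ?k (Conf_r n r))
           (cohomology_induced ?k (Conf_r n r) conf_inclusion)"
  then have trivial: "cohomology_induced ?k (Conf_r n r) conf_inclusion (angle_class n G es d\<theta>)
      = coboundaries ?k (Conf_r n r)"
    by (simp add: kernel_def cohomology_group_def FactGroup_def)
  have k: "length es = ?k"
    using assms(3,4) distinct_card by metis
  obtain f where f: "continuous_map ?T (Conf_r n r) f"
    and id: "\<And>t. t \<in> topspace ?T \<Longrightarrow> (angle_map G \<circ> conf_inclusion) (f t) = t"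
    using assms(7) by (auto simp: spins_independently_def)
  obtain \<phi> where \<phi>: "\<phi> \<in> d\<theta>" "\<phi> \<in> cocycles 1 circle" "\<phi> (frag_of loop_simplex) \<noteq> 0"
    using circle_generator_nonzero_on_loop [OF assms(5)] .
  define W where "W = cup_list ?T (map (\<lambda>e. cochain_map 1 ?T (\<lambda>t. t e) \<phi>) es)"
  have "W \<in> torus_class G es d\<theta>"
    unfolding W_def torus_class_def
    by (rule cup_list_mem_wedge)
       (simp add: list_all2_conv_all_nth cochain_map_mem_cohomology_induced \<phi>(1))
  then have "cochain_map ?k (Conf_r n r) conf_inclusion (cochain_map ?k (Conf n) (angle_map G) W)
      \<in> coboundaries ?k (Conf_r n r)" (is "?W' \<in> _")
    unfolding trivial [symmetric] angle_class_def
    by (intro cochain_map_mem_cohomology_induced)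
  \<comment> \<open>the position of an edge in the list \<open>es\<close>, so that the product and the cycle use the same order\<close>
  define idx where "idx = inv_into {..<?k} ((!) es)"
  have idx: "idx (es ! i) = i" if "i < ?k" for i
    unfolding idx_def
    by (rule inv_into_f_f) (use that k assms(3) in \<open>auto simp: inj_on_def nth_eq_iff_index_eq\<close>)
  define z where "z = torus_cycle ?k (parcs G) idx"
  have z: "singular_chain ?k ?T z"
    unfolding z_def torus_def by (rule singular_chain_torus_cycle)
  have dz: "chain_boundary ?k z = 0"
    unfolding z_def
    by (rule torus_cycle_is_cycle) (metis assms(4) idx in_set_conv_nth k)
  let ?c = "chain_map ?k f z"
  have c: "singular_chain ?k (Conf_r n r) ?c"
    by (rule singular_chain_chain_map [OF z f])
  moreover have "chain_boundary ?k ?c = 0"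
    using chain_boundary_chain_map [OF z] dz by simp
  ultimately have "?W' ?c = 0"
    by (rule coboundary_vanishes_on_cycle [OF \<open>?W' \<in> _\<close>])
  moreover have "?W' ?c = W z"
  proof -
    have incl: "chain_map ?k conf_inclusion ?c = ?c"
      using chain_map_ident [OF c] by (simp add: conf_inclusion_def)
    have "singular_chain ?k (Conf n) ?c"
      using c by (simp add: Conf_r_def singular_chain_subtopology)
    moreover have "chain_map ?k (angle_map G) ?c = z"
    proof -
      have "chain_map ?k (angle_map G) ?c = chain_map ?k (angle_map G \<circ> f) z"
        by (simp add: chain_map_compose)
      also have "\<dots> = z"
        by (rule chain_map_id_gen [OF z]) (use id in \<open>simp add: conf_inclusion_def\<close>)
      finally show ?thesis .
    qed
    ultimately show ?thesis
      using c incl by (simp add: cochain_map_def)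
  qed
  moreover have "W z = \<phi> (frag_of loop_simplex) ^ ?k"
    using cup_list_torus_cycle [OF assms(3,4) _ \<phi>(2), of idx] idx k
    by (simp add: W_def z_def torus_def)
  ultimately show False
    using \<phi>(3) by simp
qed

end
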